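(* (Three-touch case.) Let $F:\mathbb{R}^3\setminus\{\mathbf 0\}\to\mathbb{C}$ and $s:\mathbb{R}\setminus\{0\}\to\mathbb{C}$ satisfy $F(\alpha\mathbf r)=s(\alpha)F(\mathbf r)$ for all $\alpha\in\mathbb{R}\setminus\{0\}$ and $\mathbf r\neq\mathbf 0$. Let $\mathrm S=\mathrm R$ be a triangle in $\mathbb{R}^3$ with vertices $\mathbf p_1,\mathbf p_2,\mathbf p_3$ satisfying $\mathbf p_1+\mathbf p_2+\mathbf p_3=\mathbf 0$. Assume that $(\mathbf x,\mathbf x')\mapsto F(\mathbf x-\mathbf x')$ is absolutely integrable over $\mathrm R\times\mathrm S$, and let $\mathbf p,\mathbf p'\in\mathbb{R}^3$. Let $1',2',3',4'$ denote the midpoint subdivision of $\mathrm S$ and $1,2,3,4$ the (same) midpoint subdivision of $\mathrm R$, and for each superscript $\bullet\in\{1,\mathbf p',\mathbf p,\mathbf p'\mathbf p\}$ put $I^\bullet=I^\bullet_{\mathrm S\mathrm R}$ and $$I^\bullet_{\mathrm{remainder}}=\sum_{\substack{i,j\in\{1,2,3,4\}\\ i\neq j}}I^\bullet_{i'j}.$$ Then each of the following identities holds whenever the quantity inverted in it is nonzero: $$I^1=\left(1-\tfrac3{16}s\left(\tfrac12\right)-\tfrac1{16}s\left(-\tfrac12\right)\right)^{-1}I^1_{\mathrm{remainder}},$$ $$I^{\mathbf p'}=\left(1-\tfrac3{32}s\left(\tfrac12\right)+\tfrac1{32}s\left(-\tfrac12\right)\right)^{-1}I^{\mathbf p'}_{\mathrm{remainder}},$$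 $$I^{\mathbf p}=\left(1-\tfrac3{32}s\left(\tfrac12\right)+\tfrac1{32}s\left(-\tfrac12\right)\right)^{-1}I^{\mathbf p}_{\mathrm{remainder}},$$ $$I^{\mathbf p'\mathbf p}=\left(1-\tfrac3{64}s\left(\tfrac12\right)-\tfrac1{64}s\left(-\tfrac12\right)\right)^{-1}\left(I^{\mathbf p'\mathbf p}_{\mathrm{remainder}}+a^{\mathbf p'\mathbf p}\right),$$ where $$a^{\mathbf p'\mathbf p}=\tfrac1{64}s\left(\tfrac12\right)\left((\mathbf p\cdot\mathbf p_1)(\mathbf p'\cdot\mathbf p_1)+(\mathbf p\cdot\mathbf p_2)(\mathbf p'\cdot\mathbf p_2)+(\mathbf p\cdot\mathbf p_3)(\mathbf p'\cdot\mathbf p_3)\right)I^1.$$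
   Context: Triangles are closed and nondegenerate. For triangles $A,B\subset\mathbb{R}^3$ (source $A$, receiver $B$), with $dS$ denoting surface (area) measure, define $$I^1_{AB}=\int_{\mathbf x\in B}\int_{\mathbf x'\in A}F(\mathbf x-\mathbf x')\,dS(\mathbf x')\,dS(\mathbf x),$$ $$I^{\mathbf p'}_{AB}=\int_{\mathbf x\in B}\int_{\mathbf x'\in A}(\mathbf p'\cdot\mathbf x')F(\mathbf x-\mathbf x')\,dS(\mathbf x')\,dS(\mathbf x),$$ $$I^{\mathbf p}_{AB}=\int_{\mathbf x\in B}\int_{\mathbf x'\in A}(\mathbf p\cdot\mathbf x)F(\mathbf x-\mathbf x')\,dS(\mathbf x')\,dS(\mathbf x),$$ $$I^{\mathbf p'\mathbf p}_{AB}=\int_{\mathbf x\in B}\int_{\mathbf x'\in A}(\mathbf p'\cdot\mathbf x')(\mathbf p\cdot\mathbf x)F(\mathbf x-\mathbf x')\,dS(\mathbf x')\,dS(\mathbf x).$$ The value of $F$ at $\mathbf 0$ is irrelevant (the set $\mathbf x=\mathbf x'$ has measure zero in $B\times A$). Midpoint subdivision: joining the midpoints of its edges divides $\mathrm S$ into four congruent triangles; for $i=1,2,3$, $i'$ is the one containing the vertex $\mathbf p_i$ (its vertices are $\mathbf p_i$ and the midpoints of the two edges of $\mathrm S$ at $\mathbf p_i$), and $4'$ is the central one, whose vertices are the three edge midpoints. Since $\mathrm R=\mathrm S$, the triangle $i$ coincides as a set with $i'$ for $i=1,2,3,4$; the prime only indicates the role as source triangle. A subscript $i'j$ means $A=i'$,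 $B=j$. *)

theory Defs
  imports "HOL-Analysis.Analysis"
begin

text \<open>
  The area measure on an affine plane \<open>P\<close> of \<open>\<real>\<^sup>3\<close>: two-dimensional Lebesgue measure
  transported to \<open>P\<close> by an isometric parametrisation. The choice of the parametrisation is
  immaterial (\<open>plane_isometry_distr_unique\<close> below), and one exists for the plane spanned by a
  nondegenerate triangle (\<open>plane_isometry_exists\<close>).
  The completion makes all Lebesgue measurable functions on \<open>P\<close> measurable.
\<close>

definition plane_isometry :: "(real^3) set \<Rightarrow> (real^2 \<Rightarrow> real^3) \<Rightarrow> bool" where
  "plane_isometry P \<phi> \<longleftrightarrow> (\<forall>u v. dist (\<phi> u) (\<phi> v) = dist u v) \<and> range \<phi> = P"

lemma plane_isometry_exists:
  fixes p1 p2 p3 :: "real^3"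
  assumes "\<not> collinear {p1, p2, p3}"
  shows "\<exists>\<phi>. plane_isometry (affine hull (convex hull {p1, p2, p3})) \<phi>"
proof -
  let ?P = "affine hull {p1, p2, p3}"
  let ?V = "(\<lambda>x. - p1 + x) ` ?P"
  have p1: "p1 \<in> ?P"
    by (simp add: hull_inc)
  have sub: "subspace ?V"
    using affine_diffs_subspace[OF affine_affine_hull p1] by simp
  have "aff_dim {p1, p2, p3} \<le> int (card {p1, p2, p3}) - 1"
    by (rule aff_dim_le_card) simp
  moreover have "card {p1, p2, p3} \<le> 3"
    by (simp add: card_insert_if)
  moreover have "\<not> aff_dim {p1, p2, p3} \<le> 1"
    using assms by (simp add: collinear_aff_dim)
  ultimately have "aff_dim {p1, p2, p3} = 2"
    by linarith
  moreover have "aff_dim {p1, p2, p3} = int (dim ?V)"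
    using aff_dim_eq_dim[of p1 ?P] p1 by (simp add: hull_hull)
  ultimately have "dim ?V = 2"
    by simp
  then have "dim (UNIV :: (real^2) set) = dim ?V"
    by simp
  then obtain f :: "real^2 \<Rightarrow> real^3"
    where f: "linear f" "f ` UNIV = ?V" "\<And>x. norm (f x) = norm x"
    using isometry_subspaces[OF subspace_UNIV sub] by (metis UNIV_I)
  have "dist (p1 + f u) (p1 + f v) = dist u v" for u v
    using f by (simp add: dist_norm flip: linear_diff)
  moreover have "range (\<lambda>v. p1 + f v) = (+) p1 ` ?V"
    using f(2) by (metis image_image)
  then have "range (\<lambda>v. p1 + f v) = ?P"
    by (simp add: image_image)
  moreover have "affine hull (convex hull {p1, p2, p3}) = ?P"
    by simp
  ultimately show ?thesis
    unfolding plane_isometry_def by metis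
qed

lemma lborel_distr_isometry:
  fixes g :: "real^2 \<Rightarrow> real^2"
  assumes g: "\<And>u v. dist (g u) (g v) = dist u v" and "surj g"
  shows "distr lborel borel g = lborel"
proof -
  have "inj g"
    by (rule injI) (metis g dist_eq_0_iff)
  then have gh: "g (inv g x) = x" "inv g (g x) = x" for x
    using \<open>surj g\<close> by (simp_all add: surj_f_inv_f)
  define h where "h = inv g"
  define T where "T = (\<lambda>x. h x - h 0)"
  have h: "dist (h u) (h v) = dist u v" for u v
    using g[of "h u" "h v"] by (simp add: h_def gh)
  have T: "orthogonal_transformation T"
    unfolding orthogonal_transformation_isometry T_def using h by (simp add: dist_norm)
  have "continuous_on UNIV g"
    unfolding continuous_on_iff using g by metis
  then have meas: "g \<in> borel_measurable borel"
    by (rule borel_measurable_continuous_onI)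
  have "lborel = distr lborel borel g"
  proof (rule lborel_eqI)
    fix l u :: "real^2"
    assume lu: "\<And>b. b \<in> Basis \<Longrightarrow> l \<bullet> b \<le> u \<bullet> b"
    have "g -` box l u = h ` box l u"
      unfolding h_def using gh by (auto simp: image_iff) metis
    also have "\<dots> = (+) (h 0) ` T ` box l u"
      by (auto simp: T_def image_image)
    finally have pre: "g -` box l u = (+) (h 0) ` T ` box l u" .
    have lm: "T ` box l u \<in> lmeasurable"
      by (rule measurable_orthogonal_image[OF T]) simp
    have bor: "g -` box l u \<in> sets borel"
      using measurable_sets[OF meas, of "box l u"] by simp
    have "emeasure (distr lborel borel g) (box l u) = emeasure lborel (g -` box l u)"
      using meas by (subst emeasure_distr) auto
    also have "\<dots> = emeasure lebesgue (g -` box l u)"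
      using bor by simp
    also have "\<dots> = measure lebesgue (g -` box l u)"
      unfolding pre by (rule emeasure_eq_measure2) (rule measurable_translation[OF lm])
    also have "\<dots> = measure lebesgue (box l u)"
      unfolding pre by (simp only: measure_translation measure_orthogonal_image[OF T lmeasurable_box])
    also have "\<dots> = (\<Prod>b\<in>Basis. (u - l) \<bullet> b)"
      using lu by (simp add: measure_lborel_box_eq)
    finally show "emeasure (distr lborel borel g) (box l u) = (\<Prod>b\<in>Basis. (u - l) \<bullet> b)" .
  qed simp
  then show ?thesis
    by simp
qed

lemma plane_isometry_distr_unique:
  assumes \<phi>: "plane_isometry P \<phi>" and \<psi>: "plane_isometry P \<psi>"
  shows "distr lborel borel \<phi> = distr lborel borel \<psi>"
proof -
  have meas: "\<theta> \<in> borel_measurable borel" if "plane_isometry P \<theta>" for \<theta>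
  proof (rule borel_measurable_continuous_onI)
    show "continuous_on UNIV \<theta>"
      unfolding continuous_on_iff using that unfolding plane_isometry_def by metis
  qed
  have "inj \<phi>" "inj \<psi>"
    using \<phi> \<psi> unfolding plane_isometry_def by (metis dist_eq_0_iff injI)+
  define g where "g = (\<lambda>x. inv \<phi> (\<psi> x))"
  have \<phi>g: "\<phi> (g x) = \<psi> x" for x
    unfolding g_def using \<phi> \<psi> unfolding plane_isometry_def by (metis f_inv_into_f rangeI)
  have g: "dist (g u) (g v) = dist u v" for u v
    using \<phi> \<psi> unfolding plane_isometry_def by (metis \<phi>g)
  have "surj g"
  proof (rule surjI)
    fix y
    show "g (inv \<psi> (\<phi> y)) = y"
      unfolding g_def using \<phi> \<psi> \<open>inj \<phi>\<close> unfolding plane_isometry_def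
      by (metis f_inv_into_f inv_f_f rangeI)
  qed
  have gm: "g \<in> borel_measurable borel"
    by (rule borel_measurable_continuous_onI) (use g in \<open>metis continuous_on_iff\<close>)
  have "distr lborel borel \<phi> = distr (distr lborel borel g) borel \<phi>"
    using lborel_distr_isometry[OF g \<open>surj g\<close>] by simp
  also have "\<dots> = distr lborel borel (\<phi> \<circ> g)"
    using meas[OF \<phi>] gm by (intro distr_distr) auto
  also have "\<phi> \<circ> g = \<psi>"
    using \<phi>g by auto
  finally show ?thesis .
qed

definition plane_area :: "(real^3) set \<Rightarrow> (real^3) measure" where
  "plane_area P = completion (distr lborel borel (SOME \<phi>. plane_isometry P \<phi>))"

text \<open>\<open>dS A\<close> is the surface measure of the plane that contains the triangle \<open>A\<close>; it is only ever
  used to integrate over \<open>A\<close>.\<close>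

definition dS :: "(real^3) set \<Rightarrow> (real^3) measure" where
  "dS A = plane_area (affine hull A)"

definition I_one :: "(real^3 \<Rightarrow> complex) \<Rightarrow> (real^3) set \<Rightarrow> (real^3) set \<Rightarrow> complex" where
  "I_one F A B = (LINT x:B|dS B. (LINT x':A|dS A. F (x - x')))"

definition I_src ::
  "(real^3 \<Rightarrow> complex) \<Rightarrow> real^3 \<Rightarrow> (real^3) set \<Rightarrow> (real^3) set \<Rightarrow> complex" where
  "I_src F p' A B = (LINT x:B|dS B. (LINT x':A|dS A. of_real (p' \<bullet> x') * F (x - x')))"

definition I_rec ::
  "(real^3 \<Rightarrow> complex) \<Rightarrow> real^3 \<Rightarrow> (real^3) set \<Rightarrow> (real^3) set \<Rightarrow> complex" where
  "I_rec F p A B = (LINT x:B|dS B. (LINT x':A|dS A. of_real (p \<bullet> x) * F (x - x')))"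

definition I_src_rec ::
  "(real^3 \<Rightarrow> complex) \<Rightarrow> real^3 \<Rightarrow> real^3 \<Rightarrow> (real^3) set \<Rightarrow> (real^3) set \<Rightarrow> complex" where
  "I_src_rec F p' p A B =
     (LINT x:B|dS B. (LINT x':A|dS A. of_real (p' \<bullet> x') * of_real (p \<bullet> x) * F (x - x')))"

definition abs_integrable_kernel ::
  "(real^3 \<Rightarrow> complex) \<Rightarrow> (real^3) set \<Rightarrow> (real^3) set \<Rightarrow> bool" where
  "abs_integrable_kernel F A B \<longleftrightarrow>
     set_integrable (completion (dS B \<Otimes>\<^sub>M dS A)) (B \<times> A) (\<lambda>(x, x'). F (x - x'))"

text \<open>Meaningful for \<open>i \<in> {1,2,3,4}\<close> only; \<open>i = 4\<close> is the central triangle.\<close>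

definition midpoint_subdivision ::
  "real^3 \<Rightarrow> real^3 \<Rightarrow> real^3 \<Rightarrow> nat \<Rightarrow> (real^3) set" where
  "midpoint_subdivision p1 p2 p3 i =
     (if i = 1 then convex hull {p1, midpoint p1 p2, midpoint p1 p3}
      else if i = 2 then convex hull {p2, midpoint p2 p1, midpoint p2 p3}
      else if i = 3 then convex hull {p3, midpoint p3 p1, midpoint p3 p2}
      else convex hull {midpoint p1 p2, midpoint p2 p3, midpoint p3 p1})"

text \<open>\<open>J\<close> is one of the integrals above, with the source as first and the receiver as second
  argument.\<close>

definition remainder ::
  "((real^3) set \<Rightarrow> (real^3) set \<Rightarrow> complex) \<Rightarrow>
     (nat \<Rightarrow> (real^3) set) \<Rightarrow> (nat \<Rightarrow> (real^3) set) \<Rightarrow> complex" where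
  "remainder J S' R' = (\<Sum>(i, j) \<in> {(i, j) \<in> {1..4} \<times> {1..4}. i \<noteq> j}. J (S' i) (R' j))"

end

theory Submission
  imports Defs
begin

text \<open>
  Each of the four pieces of the midpoint subdivision is the image of the triangle under a
  similarity \<open>T\<^sub>i x = c\<^sub>i + \<alpha>\<^sub>i x\<close> with \<open>\<alpha>\<^sub>i = 1/2\<close> at the vertices and \<open>\<alpha>\<^sub>4 = -1/2\<close>, \<open>c\<^sub>4 = 0\<close> in the
  centre. Substituting \<open>T\<^sub>i\<close> in both variables and using the homogeneity of \<open>F\<close> turns the
  self-interaction of the \<open>i\<close>-th piece into \<open>\<alpha>\<^sub>i\<^sup>4 s(\<alpha>\<^sub>i)\<close> times an integral over the whole triangle
  whose weight is an affine combination of the four given weights. Summed over the vertex pieces,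
  the terms linear in \<open>c\<^sub>i\<close> vanish because of the centroid condition, and each identity is a
  scalar linear equation for the integral in question.
\<close>

lemma (in complete_measure) borel_measurable_cong_AE:
  assumes g: "g \<in> borel_measurable M" and ae: "AE x in M. f x = g x"
  shows "f \<in> borel_measurable M"
proof (rule measurableI)
  fix A :: "'b set" assume A: "A \<in> sets borel"
  show "f -` A \<inter> space M \<in> sets M"
  proof (rule in_sets_AE)
    show "AE x in M. x \<in> g -` A \<inter> space M \<longleftrightarrow> x \<in> f -` A \<inter> space M"
      using ae by eventually_elim auto
    show "g -` A \<inter> space M \<in> sets M"
      using g A by (rule measurable_sets)
  qed auto
qed auto

lemma (in complete_measure) integral_cong_AE_complete:
  fixes f g :: "'a \<Rightarrow> 'b::{banach, second_countable_topology}"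
  assumes ae: "AE x in M. f x = g x"
  shows "integral\<^sup>L M f = integral\<^sup>L M g"
proof (cases "g \<in> borel_measurable M")
  case True
  then show ?thesis
    using borel_measurable_cong_AE[OF True ae] ae by (intro integral_cong_AE)
next
  case False
  have "AE x in M. g x = f x"
    using ae by eventually_elim simp
  then have "f \<notin> borel_measurable M"
    using borel_measurable_cong_AE False by blast
  then show ?thesis
    using False by (metis borel_measurable_integrable not_integrable_integral_eq)
qed

lemma sigma_finite_completion:
  assumes "sigma_finite_measure M"
  shows "sigma_finite_measure (completion M)"
proof -
  interpret sigma_finite_measure M by fact
  obtain A where "countable A" "A \<subseteq> sets M" "\<Union>A = space M" "\<forall>a\<in>A. emeasure M a \<noteq> \<infinity>"
    using sigma_finite_countable by blast
  then show ?thesis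
    by (intro sigma_finite_measure.intro exI[of _ A]) (auto simp: subset_eq)
qed

lemma completion_ex_borel_measurable_complex:
  fixes f :: "'a \<Rightarrow> complex"
  assumes f: "f \<in> borel_measurable (completion M)"
  shows "\<exists>g\<in>borel_measurable M. AE x in M. f x = g x"
proof -
  have "(\<lambda>x. Re (f x)) \<in> borel_measurable (completion M)"
    "(\<lambda>x. Im (f x)) \<in> borel_measurable (completion M)"
    using f by measurable
  then obtain u v where [measurable]: "u \<in> borel_measurable M" "v \<in> borel_measurable M"
    and ae: "AE x in M. Re (f x) = u x" "AE x in M. Im (f x) = v x"
    using completion_ex_borel_measurable_real by metis
  show ?thesis
  proof (rule bexI)
    show "AE x in M. f x = Complex (u x) (v x)"
      using ae by eventually_elim (simp add: complex_eq_iff)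
    have "(\<lambda>x. complex_of_real (u x) + \<i> * complex_of_real (v x)) \<in> borel_measurable M"
      by measurable
    then show "(\<lambda>x. Complex (u x) (v x)) \<in> borel_measurable M"
      by (simp add: Complex_eq)
  qed
qed

lemma iterated_integral_eq_completion_pair:
  fixes f :: "'a \<times> 'b \<Rightarrow> complex"
  assumes "sigma_finite_measure M" "sigma_finite_measure N"
    and "complete_measure M" "complete_measure N"
    and f: "integrable (completion (M \<Otimes>\<^sub>M N)) f"
  shows "(LINT x|M. LINT y|N. f (x, y)) = integral\<^sup>L (completion (M \<Otimes>\<^sub>M N)) f"
proof -
  interpret M: sigma_finite_measure M by fact
  interpret N: sigma_finite_measure N by fact
  interpret cM: complete_measure M by fact
  interpret cN: complete_measure N by fact
  interpret pair_sigma_finite M N ..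
  obtain g where g[measurable]: "g \<in> borel_measurable (M \<Otimes>\<^sub>M N)"
    and ae: "AE z in M \<Otimes>\<^sub>M N. f z = g z"
    using completion_ex_borel_measurable_complex[OF borel_measurable_integrable[OF f]] by blast
  have ae': "AE z in completion (M \<Otimes>\<^sub>M N). f z = g z"
    using ae by (rule AE_completion)
  have g_int: "integrable (M \<Otimes>\<^sub>M N) g"
    using f ae' integrable_cong_AE[of f "completion (M \<Otimes>\<^sub>M N)" g] integrable_completion[OF g]
      borel_measurable_integrable[OF f] measurable_completion[OF g] by blast
  have "AE x in M. AE y in N. f (x, y) = g (x, y)"
    using AE_pair[OF ae] .
  then have "AE x in M. (LINT y|N. f (x, y)) = (LINT y|N. g (x, y))"
    by eventually_elim (rule cN.integral_cong_AE_complete)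
  then have "(LINT x|M. LINT y|N. f (x, y)) = (LINT x|M. LINT y|N. g (x, y))"
    by (rule cM.integral_cong_AE_complete)
  also have "\<dots> = integral\<^sup>L (M \<Otimes>\<^sub>M N) g"
    by (rule integral_fst'[OF g_int])
  also have "\<dots> = integral\<^sup>L (completion (M \<Otimes>\<^sub>M N)) g"
    by (rule integral_completion[symmetric, OF g])
  also have "\<dots> = integral\<^sup>L (completion (M \<Otimes>\<^sub>M N)) f"
    using ae' by (intro completion.integral_cong_AE_complete) auto
  finally show ?thesis .
qed

locale homogeneous_measure =
  fixes M :: "'a::euclidean_space measure" and V :: "'a set" and d :: nat
  assumes sets_M: "sets M = sets borel"
    and subspace_V: "subspace V"
    and emeasure_compact: "compact K \<Longrightarrow> emeasure M K < \<infinity>"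
    and emeasure_point: "emeasure M {x} = 0"
    and scaling: "c \<in> V \<Longrightarrow> \<alpha> \<noteq> 0 \<Longrightarrow>
      M = density (distr M borel (\<lambda>x. c + \<alpha> *\<^sub>R x)) (\<lambda>_. ennreal (\<bar>\<alpha>\<bar> ^ d))"
begin

lemma space_M: "space M = UNIV"
  using sets_eq_imp_space_eq[OF sets_M] by simp

lemma borel_in_sets: "A \<in> sets borel \<Longrightarrow> A \<in> sets M"
  by (simp add: sets_M)

lemma compact_in_sets: "compact K \<Longrightarrow> K \<in> sets M"
  by (simp add: borel_in_sets borel_compact)

sublocale sigma_finite_measure M
proof
  have "(\<Union>n. cball (0::'a) (real n)) = UNIV"
    by (auto simp: real_arch_simple)
  then show "\<exists>A. countable A \<and> A \<subseteq> sets M \<and> \<Union>A = space M \<and> (\<forall>a\<in>A. emeasure M a \<noteq> \<infinity>)"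
    using emeasure_compact[OF compact_cball] compact_in_sets[OF compact_cball]
    by (intro exI[of _ "range (\<lambda>n. cball 0 (real n))"]) (auto simp: space_M less_top)
qed

lemma affine_borel: "(\<lambda>x. c + \<alpha> *\<^sub>R x) \<in> M \<rightarrow>\<^sub>M borel"
  by (subst measurable_cong_sets[OF sets_M refl]) measurable

lemma null_sets_distr_affine:
  assumes c: "c \<in> V" and \<alpha>: "\<alpha> \<noteq> 0"
  shows "null_sets M = null_sets (distr M borel (\<lambda>x. c + \<alpha> *\<^sub>R x))" (is "_ = null_sets ?D")
proof -
  have "emeasure M A = 0 \<longleftrightarrow> emeasure ?D A = 0" if A: "A \<in> sets borel" for A
  proof -
    have "emeasure M A = emeasure (density ?D (\<lambda>_. ennreal (\<bar>\<alpha>\<bar> ^ d))) A"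
      using scaling[OF c \<alpha>] by simp
    also have "\<dots> = ennreal (\<bar>\<alpha>\<bar> ^ d) * emeasure ?D A"
      using A by (simp add: emeasure_density nn_integral_cmult)
    finally show ?thesis
      using \<alpha> by simp
  qed
  then show ?thesis
    by (auto simp: null_sets_def sets_M)
qed

lemma affine_completion:
  assumes c: "c \<in> V" and \<alpha>: "\<alpha> \<noteq> 0"
  shows "(\<lambda>x. c + \<alpha> *\<^sub>R x) \<in> completion M \<rightarrow>\<^sub>M completion M"
proof (rule completion.measurable_completion2)
  let ?T = "\<lambda>x. c + \<alpha> *\<^sub>R x"
  show T: "?T \<in> completion M \<rightarrow>\<^sub>M M"
    using measurable_completion[OF affine_borel] measurable_cong_sets[OF refl sets_M] by blast
  have TM: "?T \<in> M \<rightarrow>\<^sub>M M"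
    using affine_borel measurable_cong_sets[OF refl sets_M] by blast
  have "distr (completion M) M ?T = distr M M ?T"
    using TM by (rule distr_completion)
  also have "\<dots> = distr M borel ?T"
    by (rule distr_cong) (auto simp: sets_M)
  finally show "null_sets M \<subseteq> null_sets (distr (completion M) M ?T)"
    using null_sets_distr_affine[OF c \<alpha>] by simp
qed

lemma scaling_completion:
  assumes c: "c \<in> V" and \<alpha>: "\<alpha> \<noteq> 0"
  shows "completion M =
    density (distr (completion M) (completion M) (\<lambda>x. c + \<alpha> *\<^sub>R x)) (\<lambda>_. ennreal (\<bar>\<alpha>\<bar> ^ d))"
proof -
  let ?T = "\<lambda>x. c + \<alpha> *\<^sub>R x"
  have TM: "?T \<in> M \<rightarrow>\<^sub>M M"
    using affine_borel measurable_cong_sets[OF refl sets_M] by blast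
  have D: "distr (completion M) M ?T = distr M borel ?T"
    unfolding distr_completion[OF TM] by (rule distr_cong) (auto simp: sets_M)
  have "completion M = completion (density (distr M borel ?T) (\<lambda>_. ennreal (\<bar>\<alpha>\<bar> ^ d)))"
    using scaling[OF c \<alpha>] by simp
  also have "\<dots> = density (completion (distr M borel ?T)) (\<lambda>_. ennreal (\<bar>\<alpha>\<bar> ^ d))"
    using \<alpha> by (intro completion_density_eq) auto
  also have "completion (distr M borel ?T) = distr (completion M) (completion M) ?T"
    unfolding D[symmetric]
    using null_sets_distr_affine[OF c \<alpha>] D TM
    by (intro completion.completion_distr_eq) (auto intro: measurable_completion)
  finally show ?thesis .
qed

text \<open>Bijectivity of the substitution makes any integrability hypothesis superfluous: if one side
  is not integrable, both integrals have the junk value \<open>0\<close>.\<close>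

lemma integral_affine:
  fixes f :: "'a \<Rightarrow> 'b::{banach, second_countable_topology}"
  assumes c: "c \<in> V" and \<alpha>: "\<alpha> \<noteq> 0"
  shows "(LINT x|completion M. f x) = \<bar>\<alpha>\<bar> ^ d *\<^sub>R (LINT x|completion M. f (c + \<alpha> *\<^sub>R x))"
proof -
  let ?C = "completion M" and ?T = "\<lambda>x. c + \<alpha> *\<^sub>R x"
  have T[measurable]: "?T \<in> ?C \<rightarrow>\<^sub>M ?C"
    using c \<alpha> by (rule affine_completion)
  show ?thesis
  proof (cases "f \<in> borel_measurable ?C")
    case True
    have "integral\<^sup>L ?C f = integral\<^sup>L (density (distr ?C ?C ?T) (\<lambda>_. ennreal (\<bar>\<alpha>\<bar> ^ d))) f"
      using scaling_completion[OF c \<alpha>] by simp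
    also have "\<dots> = \<bar>\<alpha>\<bar> ^ d *\<^sub>R (LINT x|distr ?C ?C ?T. f x)"
      using True by (subst integral_density) auto
    also have "\<dots> = \<bar>\<alpha>\<bar> ^ d *\<^sub>R (LINT x|?C. f (?T x))"
      using True by (subst integral_distr) auto
    finally show ?thesis .
  next
    case False
    let ?U = "\<lambda>x. - ((1/\<alpha>) *\<^sub>R c) + (1/\<alpha>) *\<^sub>R x"
    have U: "?U \<in> ?C \<rightarrow>\<^sub>M ?C"
      using \<alpha> c subspace_V by (intro affine_completion) (auto simp: subspace_def subspace_neg)
    have TU: "?T (?U x) = x" for x
      using \<alpha> by (simp add: algebra_simps)
    have "(\<lambda>x. f (?T x)) \<notin> borel_measurable ?C"
    proof
      assume "(\<lambda>x. f (?T x)) \<in> borel_measurable ?C"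
      from measurable_compose[OF U this] show False
        using False unfolding TU by simp
    qed
    then show ?thesis
      using False by (metis borel_measurable_integrable not_integrable_integral_eq scaleR_zero_right)
  qed
qed


lemma compact_affine_image:
  fixes S :: "'a set"
  shows "compact S \<Longrightarrow> compact ((\<lambda>x. c + \<alpha> *\<^sub>R x) ` S)"
  by (intro compact_continuous_image continuous_intros)

lemma indicator_affine_image:
  assumes "\<alpha> \<noteq> 0"
  shows "indicator ((\<lambda>x. c + \<alpha> *\<^sub>R x) ` S) (c + \<alpha> *\<^sub>R x) = indicator S (x :: 'a)"
  using assms by (auto simp: indicator_def)

lemma integrable_indicator_compact:
  assumes "compact K"
  shows "integrable (completion M) (\<lambda>x. indicator K x :: real)"
  using compact_in_sets[OF assms] emeasure_compact[OF assms]
  by (simp add: integrable_indicator_iff)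

text \<open>The sum of the indicators of the pieces dominates the indicator of the covered set, and both
  have the same integral because the ratios satisfy \<open>\<Sum> \<bar>\<alpha> i\<bar> ^ d = 1\<close>. So the overlaps need not
  be examined.\<close>

lemma AE_indicator_self_similar:
  fixes S :: "'a set" and T :: "'i \<Rightarrow> 'a \<Rightarrow> 'a"
  assumes I: "finite I" and S: "compact S"
    and T: "\<And>i x. i \<in> I \<Longrightarrow> T i x = c i + \<alpha> i *\<^sub>R x"
    and c: "\<And>i. i \<in> I \<Longrightarrow> c i \<in> V" and \<alpha>: "\<And>i. i \<in> I \<Longrightarrow> \<alpha> i \<noteq> 0"
    and ratios: "(\<Sum>i\<in>I. \<bar>\<alpha> i\<bar> ^ d) = 1"
    and cover: "S = (\<Union>i\<in>I. T i ` S)"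
  shows "AE x in completion M. indicator S x = (\<Sum>i\<in>I. indicator (T i ` S) x :: real)"
proof -
  have Ti: "T i = (\<lambda>x. c i + \<alpha> i *\<^sub>R x)" if "i \<in> I" for i
    using T[OF that] by auto
  have K: "compact (T i ` S)" if "i \<in> I" for i
    using Ti[OF that] compact_affine_image[OF S] by simp
  define h :: "'a \<Rightarrow> real" where "h = (\<lambda>x. (\<Sum>i\<in>I. indicator (T i ` S) x) - indicator S x)"
  have nonneg: "0 \<le> h x" for x
  proof (cases "x \<in> S")
    case True
    then obtain j where j: "j \<in> I" "x \<in> T j ` S"
      using cover by blast
    then have "indicator (T j ` S) x \<le> (\<Sum>i\<in>I. indicator (T i ` S) x :: real)"
      using I by (intro member_le_sum) auto
    then show ?thesis
      using True j by (simp add: h_def)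
  qed (auto simp: h_def intro!: sum_nonneg)
  have int_sum: "integrable (completion M) (\<lambda>x. \<Sum>i\<in>I. indicator (T i ` S) x :: real)"
    using integrable_indicator_compact[OF K] by (intro Bochner_Integration.integrable_sum)
  have int: "integrable (completion M) h"
    unfolding h_def
    by (rule Bochner_Integration.integrable_diff[OF int_sum integrable_indicator_compact[OF S]])
  have piece: "(LINT x|completion M. indicator (T i ` S) x) =
      \<bar>\<alpha> i\<bar> ^ d * (LINT x|completion M. indicator S x :: real)" if "i \<in> I" for i
    using integral_affine[OF c[OF that] \<alpha>[OF that], of "indicator (T i ` S) :: 'a \<Rightarrow> real"]
    by (simp add: Ti[OF that] indicator_affine_image[OF \<alpha>[OF that]])
  have "integral\<^sup>L (completion M) h =
      (\<Sum>i\<in>I. LINT x|completion M. indicator (T i ` S) x) - (LINT x|completion M. indicator S x)"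
    unfolding h_def
    by (subst Bochner_Integration.integral_diff[OF int_sum integrable_indicator_compact[OF S]],
        subst Bochner_Integration.integral_sum)
      (use integrable_indicator_compact[OF K] in auto)
  also have "\<dots> = ((\<Sum>i\<in>I. \<bar>\<alpha> i\<bar> ^ d) - 1) * (LINT x|completion M. indicator S x)"
    by (subst sum.cong[OF refl piece]) (auto simp: left_diff_distrib sum_distrib_right)
  finally have "integral\<^sup>L (completion M) h = 0"
    using ratios by simp
  then have "AE x in completion M. h x = 0"
    using integral_nonneg_eq_0_iff_AE[OF int] nonneg by simp
  then show ?thesis
    by eventually_elim (simp add: h_def)
qed

definition double_integral ::
    "('a \<Rightarrow> complex) \<Rightarrow> ('a \<Rightarrow> 'a \<Rightarrow> complex) \<Rightarrow> 'a set \<Rightarrow> 'a set \<Rightarrow> complex" where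
  "double_integral F w A B =
    (LINT x:B|completion M. (LINT x':A|completion M. w x x' * F (x - x')))"

lemma double_integral_cmult:
  "double_integral F (\<lambda>x x'. k * w x x') A B = k * double_integral F w A B"
  unfolding double_integral_def by (simp add: mult.assoc)

lemma double_integral_affine_image:
  assumes hom: "\<And>r. r \<noteq> 0 \<Longrightarrow> F (\<alpha> *\<^sub>R r) = s * F r"
    and c: "c \<in> V" and \<alpha>: "\<alpha> \<noteq> 0"
    and T: "\<And>x. T x = c + \<alpha> *\<^sub>R x"
  shows "double_integral F w (T ` A) (T ` B) =
    of_real (\<bar>\<alpha>\<bar> ^ (2 * d)) * s * double_integral F (\<lambda>x x'. w (T x) (T x')) A B"
proof -
  have Teq: "T = (\<lambda>x. c + \<alpha> *\<^sub>R x)"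
    using T by auto
  have diff: "T x - T x' = \<alpha> *\<^sub>R (x - x')" for x x'
    by (simp add: T algebra_simps)
  have ind: "indicator (T ` C) (T x) = (indicator C x :: real)" for C x
    unfolding Teq using \<alpha> by (rule indicator_affine_image)
  have sub: "integral\<^sup>L (completion M) g = of_real (\<bar>\<alpha>\<bar> ^ d) * (LINT x|completion M. g (T x))"
    for g :: "'a \<Rightarrow> complex"
    using integral_affine[OF c \<alpha>, of g] by (simp add: Teq scaleR_conv_of_real)
  have point: "AE x' in completion M. x' \<noteq> x" for x
    using emeasure_point[of x] borel_in_sets[of "{x}"]
    by (intro AE_completion AE_not_in[of "{x}", simplified]) (auto intro!: null_setsI)
  have inner: "(LINT x':A|completion M. w (T x) (T x') * F (T x - T x')) =
      s * (LINT x':A|completion M. w (T x) (T x') * F (x - x'))" for x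
  proof -
    have "(LINT x':A|completion M. w (T x) (T x') * F (T x - T x')) =
        (LINT x':A|completion M. s * (w (T x) (T x') * F (x - x')))"
      unfolding set_lebesgue_integral_def
    proof (rule completion.integral_cong_AE_complete)
      show "AE x' in completion M. indicator A x' *\<^sub>R (w (T x) (T x') * F (T x - T x')) =
          indicator A x' *\<^sub>R (s * (w (T x) (T x') * F (x - x')))"
        using point[of x] by eventually_elim (simp add: diff hom)
    qed
    then show ?thesis
      by simp
  qed
  have "(LINT x':T ` A|completion M. w (T x) x' * F (T x - x')) =
      of_real (\<bar>\<alpha>\<bar> ^ d) * s * (LINT x':A|completion M. w (T x) (T x') * F (x - x'))" for x
    using inner[of x] unfolding set_lebesgue_integral_def by (subst sub) (simp add: ind)
  then have "double_integral F w (T ` A) (T ` B) =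
      of_real (\<bar>\<alpha>\<bar> ^ d) * (LINT x:B|completion M.
        of_real (\<bar>\<alpha>\<bar> ^ d) * s * (LINT x':A|completion M. w (T x) (T x') * F (x - x')))"
    unfolding double_integral_def set_lebesgue_integral_def[of _ "T ` B"]
      set_lebesgue_integral_def[of _ B]
    by (subst sub) (simp add: ind)
  also have "\<dots> = of_real (\<bar>\<alpha>\<bar> ^ (2 * d)) * s * double_integral F (\<lambda>x x'. w (T x) (T x')) A B"
    unfolding double_integral_def by (simp add: mult_2 power_add)
  finally show ?thesis .
qed


abbreviation pair_area :: "('a \<times> 'a) measure" where
  "pair_area \<equiv> completion (completion M \<Otimes>\<^sub>M completion M)"

lemma borel_measurable_pair_area:
  fixes f :: "'a \<times> 'a \<Rightarrow> 'b::topological_space"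
  assumes "f \<in> borel_measurable borel"
  shows "f \<in> borel_measurable pair_area"
proof -
  have id: "(\<lambda>x. x) \<in> completion M \<rightarrow>\<^sub>M borel"
    by (rule measurable_completion) (simp add: measurable_ident_sets[OF sets_M])
  have "(\<lambda>z. (fst z, snd z)) \<in> completion M \<Otimes>\<^sub>M completion M \<rightarrow>\<^sub>M borel \<Otimes>\<^sub>M borel"
    by (intro measurable_Pair measurable_compose[OF measurable_fst id]
        measurable_compose[OF measurable_snd id])
  then have "(\<lambda>z. z) \<in> completion M \<Otimes>\<^sub>M completion M \<rightarrow>\<^sub>M (borel :: ('a \<times> 'a) measure)"
    by (simp add: borel_prod)
  from measurable_compose[OF this assms] show ?thesis
    by (rule measurable_completion)
qed

lemma AE_pair_area:
  assumes "AE x in completion M. P x" and P: "Measurable.pred borel P"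
  shows "AE z in pair_area. P (fst z) \<and> P (snd z)"
proof -
  interpret C: sigma_finite_measure "completion M"
    by (rule sigma_finite_completion) unfold_locales
  interpret pair_sigma_finite "completion M" "completion M" ..
  have P': "Measurable.pred (completion M) P"
    using P by (intro measurable_completion) (simp add: measurable_cong_sets[OF sets_M refl])
  have "AE z in completion M \<Otimes>\<^sub>M completion M. P (fst z) \<and> P (snd z)"
  proof (rule AE_pair_measure)
    show "{z \<in> space (completion M \<Otimes>\<^sub>M completion M). P (fst z) \<and> P (snd z)}
        \<in> sets (completion M \<Otimes>\<^sub>M completion M)"
      using P' by measurable
    show "AE x in completion M. AE y in completion M. P (fst (x, y)) \<and> P (snd (x, y))"
      using assms(1) by eventually_elim (use assms(1) in simp)
  qed
  then show ?thesis
    by (rule AE_completion)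
qed

lemma set_integrable_weighted_kernel:
  assumes S: "compact S" and w: "continuous_on UNIV (\<lambda>z. w (fst z) (snd z))"
    and F: "set_integrable pair_area (S \<times> S) (\<lambda>(x, x'). F (x - x'))"
    and A: "compact A" "A \<subseteq> S" and B: "compact B" "B \<subseteq> S"
  shows "set_integrable pair_area (B \<times> A) (\<lambda>z. w (fst z) (snd z) * F (fst z - snd z) :: complex)"
proof -
  let ?w = "\<lambda>z. w (fst z) (snd z)"
  have "compact (?w ` (S \<times> S))"
    using continuous_on_subset[OF w subset_UNIV] compact_Times[OF S S]
    by (rule compact_continuous_image)
  then obtain C where "\<forall>y\<in>?w ` (S \<times> S). norm y \<le> C"
    by (meson compact_imp_bounded bounded_iff)
  then have C: "norm (?w z) \<le> C" if "z \<in> S \<times> S" for z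
    using imageI[OF that, of ?w] by (rule bspec)
  have BA: "(\<lambda>z. indicator (B \<times> A) z *\<^sub>R ?w z) \<in> borel_measurable pair_area"
    using borel_measurable_continuous_onI[OF w] borel_compact[OF compact_Times[OF B(1) A(1)]]
    by (intro borel_measurable_pair_area borel_measurable_scaleR borel_measurable_indicator)
  have F': "integrable pair_area (\<lambda>z. indicator (S \<times> S) z *\<^sub>R F (fst z - snd z))"
    using F by (simp add: set_integrable_def case_prod_beta)
  have "integrable pair_area
      (\<lambda>z. (indicator (B \<times> A) z *\<^sub>R ?w z) * (indicator (S \<times> S) z *\<^sub>R F (fst z - snd z)))"
  proof (rule Bochner_Integration.integrable_bound)
    show "integrable pair_area (\<lambda>z. C *\<^sub>R (indicator (S \<times> S) z *\<^sub>R F (fst z - snd z)))"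
      by (intro integrable_scaleR_right F')
    show "(\<lambda>z. (indicator (B \<times> A) z *\<^sub>R ?w z) * (indicator (S \<times> S) z *\<^sub>R F (fst z - snd z)))
        \<in> borel_measurable pair_area"
      using BA borel_measurable_integrable[OF F'] by (rule borel_measurable_times)
    show "AE z in pair_area.
        norm ((indicator (B \<times> A) z *\<^sub>R ?w z) * (indicator (S \<times> S) z *\<^sub>R F (fst z - snd z)))
        \<le> norm (C *\<^sub>R (indicator (S \<times> S) z *\<^sub>R F (fst z - snd z)))"
    proof (rule AE_I2)
      fix z
      show "norm ((indicator (B \<times> A) z *\<^sub>R ?w z) * (indicator (S \<times> S) z *\<^sub>R F (fst z - snd z)))
        \<le> norm (C *\<^sub>R (indicator (S \<times> S) z *\<^sub>R F (fst z - snd z)))"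
      proof (cases "z \<in> B \<times> A")
        case True
        then have "z \<in> S \<times> S"
          using A B by auto
        then show ?thesis
          using True C[of z] by (simp add: norm_mult mult_right_mono)
      qed simp
    qed
  qed
  moreover have "(indicator (B \<times> A) z *\<^sub>R ?w z) * (indicator (S \<times> S) z *\<^sub>R F (fst z - snd z)) =
      indicator (B \<times> A) z *\<^sub>R (?w z * F (fst z - snd z))" for z
    using A B by (auto simp: indicator_def)
  ultimately show ?thesis
    by (simp only: set_integrable_def)
qed

lemma double_integral_eq_pair_area:
  assumes "set_integrable pair_area (B \<times> A) (\<lambda>z. w (fst z) (snd z) * F (fst z - snd z) :: complex)"
  shows "double_integral F w A B =
    (LINT z:B \<times> A|pair_area. w (fst z) (snd z) * F (fst z - snd z))"
proof -
  let ?f = "\<lambda>z. indicator (B \<times> A) z *\<^sub>R (w (fst z) (snd z) * F (fst z - snd z))"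
  have C: "sigma_finite_measure (completion M)"
    by (rule sigma_finite_completion) unfold_locales
  have "(LINT x|completion M. LINT x'|completion M. ?f (x, x')) = integral\<^sup>L pair_area ?f"
    using C assms unfolding set_integrable_def
    by (intro iterated_integral_eq_completion_pair) (auto intro: completion.complete_measure_axioms)
  moreover have "?f (x, x') = indicator B x *\<^sub>R (indicator A x' *\<^sub>R (w x x' * F (x - x')))" for x x'
    by (simp add: indicator_times)
  ultimately show ?thesis
    by (simp only: double_integral_def set_lebesgue_integral_def integral_scaleR_right)
qed

context
  fixes F :: "'a \<Rightarrow> complex" and S :: "'a set"
  assumes S: "compact S" and F: "set_integrable pair_area (S \<times> S) (\<lambda>(x, x'). F (x - x'))"
begin

lemmas kernel_integrable = set_integrable_weighted_kernel[OF S _ F]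

lemma double_integral_add:
  assumes "continuous_on UNIV (\<lambda>z. v (fst z) (snd z))" "continuous_on UNIV (\<lambda>z. w (fst z) (snd z))"
  shows "double_integral F (\<lambda>x x'. v x x' + w x x') S S =
    double_integral F v S S + double_integral F w S S"
proof -
  note int = kernel_integrable[OF _ S order_refl S order_refl]
  note eq = double_integral_eq_pair_area[OF int]
  show ?thesis
    using eq[OF assms(1)] eq[OF assms(2)]
      eq[of "\<lambda>x x'. v x x' + w x x'", OF continuous_on_add[OF assms]]
      set_integral_add(2)[OF int[OF assms(1)] int[OF assms(2)]]
    by (simp add: distrib_right)
qed

lemma double_integral_split:
  assumes w: "continuous_on UNIV (\<lambda>z. w (fst z) (snd z))"
    and I: "finite I" and K: "\<And>i. i \<in> I \<Longrightarrow> compact (K i)" "\<And>i. i \<in> I \<Longrightarrow> K i \<subseteq> S"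
    and ae: "AE x in completion M. indicator S x = (\<Sum>i\<in>I. indicator (K i) x :: real)"
  shows "double_integral F w S S = (\<Sum>(i, j)\<in>I \<times> I. double_integral F w (K i) (K j))"
proof -
  let ?f = "\<lambda>z. w (fst z) (snd z) * F (fst z - snd z)"
  note int = kernel_integrable[OF w]
  have ae2: "AE z in pair_area. indicator S (fst z) = (\<Sum>i\<in>I. indicator (K i) (fst z) :: real) \<and>
      indicator S (snd z) = (\<Sum>i\<in>I. indicator (K i) (snd z) :: real)"
  proof (rule AE_pair_area[OF ae])
    have [measurable]: "S \<in> sets borel"
      using S by (rule borel_compact)
    have [measurable]: "(\<lambda>x. \<Sum>i\<in>I. indicator (K i) x :: real) \<in> borel_measurable borel"
      using K borel_compact by (intro borel_measurable_sum borel_measurable_indicator) auto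
    show "Measurable.pred borel (\<lambda>x. indicator S x = (\<Sum>i\<in>I. indicator (K i) x :: real))"
      by measurable
  qed
  have "double_integral F w S S = (LINT z:S \<times> S|pair_area. ?f z)"
    by (rule double_integral_eq_pair_area[OF int[OF S order_refl S order_refl]])
  also have "\<dots> = (LINT z|pair_area. (\<Sum>(i, j)\<in>I \<times> I. indicator (K j \<times> K i) z *\<^sub>R ?f z))"
    unfolding set_lebesgue_integral_def
  proof (rule completion.integral_cong_AE_complete)
    show "AE z in pair_area. indicator (S \<times> S) z *\<^sub>R ?f z =
        (\<Sum>(i, j)\<in>I \<times> I. indicator (K j \<times> K i) z *\<^sub>R ?f z)"
      using ae2
    proof eventually_elim
      case (elim z)
      have "(indicator (S \<times> S) z :: real) = indicator S (snd z) * indicator S (fst z)"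
        by (cases z) (simp add: indicator_times)
      also have "\<dots> = (\<Sum>i\<in>I. \<Sum>j\<in>I. indicator (K i) (snd z) * indicator (K j) (fst z))"
        by (simp add: elim[THEN conjunct1] elim[THEN conjunct2] sum_product)
      also have "\<dots> = (\<Sum>(i, j)\<in>I \<times> I. indicator (K j \<times> K i) z)"
        by (cases z) (simp add: sum.cartesian_product indicator_times mult.commute)
      finally show ?case
        by (simp add: scaleR_sum_left case_prod_beta)
    qed
  qed
  also have "\<dots> = (\<Sum>(i, j)\<in>I \<times> I. LINT z:K j \<times> K i|pair_area. ?f z)"
    unfolding set_lebesgue_integral_def case_prod_beta
    using int[OF K(1) K(2) K(1) K(2)]
    by (intro Bochner_Integration.integral_sum) (auto simp: set_integrable_def)
  also have "\<dots> = (\<Sum>(i, j)\<in>I \<times> I. double_integral F w (K i) (K j))"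
    using double_integral_eq_pair_area[OF int[OF K(1) K(2) K(1) K(2)]]
    by (intro sum.cong) auto
  finally show ?thesis .
qed

end

lemma double_integral_self_similar:
  fixes S :: "'a set" and T :: "'i \<Rightarrow> 'a \<Rightarrow> 'a"
  assumes S: "compact S" and F: "set_integrable pair_area (S \<times> S) (\<lambda>(x, x'). F (x - x'))"
    and w: "continuous_on UNIV (\<lambda>z. w (fst z) (snd z))"
    and hom: "\<And>\<alpha> r. \<alpha> \<noteq> 0 \<Longrightarrow> r \<noteq> 0 \<Longrightarrow> F (\<alpha> *\<^sub>R r) = s \<alpha> * F r"
    and I: "finite I"
    and T: "\<And>i x. i \<in> I \<Longrightarrow> T i x = c i + \<alpha> i *\<^sub>R x"
    and c: "\<And>i. i \<in> I \<Longrightarrow> c i \<in> V" and \<alpha>: "\<And>i. i \<in> I \<Longrightarrow> \<alpha> i \<noteq> 0"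
    and ratios: "(\<Sum>i\<in>I. \<bar>\<alpha> i\<bar> ^ d) = 1"
    and cover: "S = (\<Union>i\<in>I. T i ` S)"
  shows "double_integral F w S S =
    (\<Sum>i\<in>I. of_real (\<bar>\<alpha> i\<bar> ^ (2 * d)) * s (\<alpha> i) *
      double_integral F (\<lambda>x x'. w (T i x) (T i x')) S S) +
    (\<Sum>(i, j)\<in>{(i, j) \<in> I \<times> I. i \<noteq> j}. double_integral F w (T i ` S) (T j ` S))"
proof -
  let ?J = "\<lambda>(i, j). double_integral F w (T i ` S) (T j ` S)"
  have K: "compact (T i ` S)" if "i \<in> I" for i
  proof -
    have "T i = (\<lambda>x. c i + \<alpha> i *\<^sub>R x)"
      using T[OF that] by auto
    then show ?thesis
      using compact_affine_image[OF S] by simp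
  qed
  have "double_integral F w S S = sum ?J (I \<times> I)"
    using K cover AE_indicator_self_similar[OF I S T c \<alpha> ratios cover]
    by (intro double_integral_split[OF S F w I]) auto
  also have "\<dots> = sum ?J ((\<lambda>i. (i, i)) ` I) + sum ?J {(i, j) \<in> I \<times> I. i \<noteq> j}"
    using I by (subst sum.union_disjoint[symmetric])
      (auto intro!: sum.cong intro: finite_subset[of _ "I \<times> I"])
  also have "sum ?J ((\<lambda>i. (i, i)) ` I) = (\<Sum>i\<in>I. double_integral F w (T i ` S) (T i ` S))"
    by (subst sum.reindex) (auto simp: inj_on_def)
  also have "\<dots> = (\<Sum>i\<in>I. of_real (\<bar>\<alpha> i\<bar> ^ (2 * d)) * s (\<alpha> i) *
      double_integral F (\<lambda>x x'. w (T i x) (T i x')) S S)"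
    using hom c \<alpha> T by (intro sum.cong refl double_integral_affine_image) auto
  finally show ?thesis .
qed

end

lemma dist_scaleR_same:
  "dist (a *\<^sub>R x) (a *\<^sub>R y) = \<bar>a\<bar> * dist x (y :: 'a::real_normed_vector)"
  by (simp add: dist_norm flip: scaleR_diff_right)

lemma distr_similarity_lborel:
  fixes T :: "real^2 \<Rightarrow> real^2"
  assumes \<alpha>: "\<alpha> \<noteq> 0" and T: "\<And>u v. dist (T u) (T v) = \<bar>\<alpha>\<bar> * dist u v" and "surj T"
  shows "density (distr lborel borel T) (\<lambda>_. ennreal (\<bar>\<alpha>\<bar> ^ 2)) = lborel"
proof -
  define g where "g = (\<lambda>u. (1/\<alpha>) *\<^sub>R T u)"
  have Tg: "T u = \<alpha> *\<^sub>R g u" for u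
    using \<alpha> by (simp add: g_def)
  have g: "dist (g u) (g v) = dist u v" for u v
    using T[of u v] \<alpha> by (simp add: Tg dist_scaleR_same)
  have "surj g"
  proof (rule surjI)
    fix y
    show "g (inv T (\<alpha> *\<^sub>R y)) = y"
      using \<open>surj T\<close> \<alpha> by (simp add: g_def surj_f_inv_f)
  qed
  have "continuous_on UNIV g"
    unfolding continuous_on_iff using g by metis
  then have gm: "g \<in> borel_measurable borel"
    by (rule borel_measurable_continuous_onI)
  have "distr lborel borel T = distr (distr lborel borel g) borel (\<lambda>u. \<alpha> *\<^sub>R u)"
    using gm by (subst distr_distr) (auto simp: comp_def simp flip: Tg)
  also have "\<dots> = distr lborel borel (\<lambda>u. \<alpha> *\<^sub>R u)"
    using lborel_distr_isometry[OF g \<open>surj g\<close>] by simp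
  finally show ?thesis
    using lborel_affine[OF \<alpha>, of "0 :: real^2"] by simp
qed

lemma homogeneous_measure_plane:
  assumes \<phi>: "plane_isometry P \<phi>" and P: "subspace P"
  shows "homogeneous_measure (distr lborel borel \<phi>) P 2"
proof
  let ?M = "distr lborel borel \<phi> :: (real^3) measure"
  have dist: "dist (\<phi> u) (\<phi> v) = dist u v" and range: "range \<phi> = P" for u v
    using \<phi> by (auto simp: plane_isometry_def)
  have inj: "inj \<phi>"
    by (rule injI) (metis dist dist_eq_0_iff)
  have cont: "continuous_on UNIV \<phi>"
    unfolding continuous_on_iff using dist by metis
  then have meas: "\<phi> \<in> borel_measurable borel"
    by (rule borel_measurable_continuous_onI)
  have em: "emeasure ?M A = emeasure lborel (\<phi> -` A)" if "A \<in> sets borel" for A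
    using meas that by (subst emeasure_distr) auto
  show "sets ?M = sets borel"
    by simp
  show "subspace P"
    by fact
  show "emeasure ?M K < \<infinity>" if K: "compact K" for K
  proof -
    have "bounded (\<phi> -` K)"
    proof -
      obtain e where e: "\<And>y. y \<in> K \<Longrightarrow> dist (\<phi> 0) y \<le> e"
        using compact_imp_bounded[OF K] bounded_any_center[of K "\<phi> 0"] by auto
      have "dist 0 u \<le> e" if "u \<in> \<phi> -` K" for u
        using e[of "\<phi> u"] that dist[of 0 u] by simp
      then show ?thesis
        unfolding bounded_def by blast
    qed
    moreover have "\<phi> -` K \<in> sets lborel"
      using measurable_sets[OF meas borel_compact[OF K]] by simp
    ultimately show ?thesis
      using em[OF borel_compact[OF K]] emeasure_bounded_finite by simp
  qed
  show "emeasure ?M {x} = 0" for x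
  proof -
    have "finite (\<phi> -` {x})"
      using inj by (intro finite_vimageI) auto
    then show ?thesis
      using em[of "{x}"] by (simp add: emeasure_lborel_countable countable_finite)
  qed
  show "?M = density (distr ?M borel (\<lambda>x. c + \<alpha> *\<^sub>R x)) (\<lambda>_. ennreal (\<bar>\<alpha>\<bar> ^ 2))"
    if c: "c \<in> P" and \<alpha>: "\<alpha> \<noteq> 0" for c \<alpha>
  proof -
    let ?T = "\<lambda>x. c + \<alpha> *\<^sub>R x"
    define T where "T = (\<lambda>u. inv \<phi> (?T (\<phi> u)))"
    have \<phi>T: "\<phi> (T u) = ?T (\<phi> u)" for u
    proof -
      have "?T (\<phi> u) \<in> range \<phi>"
        using c P range by (metis rangeI subspace_add subspace_scale)
      then show ?thesis
        unfolding T_def by (rule f_inv_into_f)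
    qed
    have T: "dist (T u) (T v) = \<bar>\<alpha>\<bar> * dist u v" for u v
    proof -
      have "dist (T u) (T v) = dist (?T (\<phi> u)) (?T (\<phi> v))"
        using dist[of "T u" "T v"] by (simp add: \<phi>T)
      also have "\<dots> = \<bar>\<alpha>\<bar> * dist u v"
        by (simp add: dist dist_scaleR_same)
      finally show ?thesis .
    qed
    have "surj T"
    proof (rule surjI)
      fix y
      let ?z = "(1/\<alpha>) *\<^sub>R (\<phi> y - c)"
      have "?z \<in> range \<phi>"
        using c P range by (metis rangeI subspace_diff subspace_scale)
      then have "\<phi> (T (inv \<phi> ?z)) = \<phi> y"
        using \<alpha> by (simp add: \<phi>T f_inv_into_f)
      then show "T (inv \<phi> ?z) = y"
        using inj by (simp add: inj_eq)
    qed
    have "continuous_on UNIV T"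
      using T \<alpha> by (intro lipschitz_on_continuous_on[of "\<bar>\<alpha>\<bar>"] lipschitz_onI) auto
    then have Tm: "T \<in> borel_measurable borel"
      by (rule borel_measurable_continuous_onI)
    have "distr ?M borel ?T = distr lborel borel (\<lambda>u. ?T (\<phi> u))"
      using meas by (subst distr_distr) (auto simp: comp_def)
    also have "\<dots> = distr (distr lborel borel T) borel \<phi>"
      using meas Tm by (subst distr_distr) (auto simp: comp_def \<phi>T)
    finally have "density (distr ?M borel ?T) (\<lambda>_. ennreal (\<bar>\<alpha>\<bar> ^ 2)) =
        distr (density (distr lborel borel T) (\<lambda>_. ennreal (\<bar>\<alpha>\<bar> ^ 2))) borel \<phi>"
      using meas by (simp add: density_distr)
    also have "\<dots> = ?M"
      using distr_similarity_lborel[OF \<alpha> T \<open>surj T\<close>] by simp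
    finally show ?thesis
      by simp
  qed
qed

definition subdivision_ratio :: "nat \<Rightarrow> real" where
  "subdivision_ratio i = (if i \<in> {1, 2, 3} then 1/2 else -1/2)"

definition subdivision_shift :: "'a::real_vector \<Rightarrow> 'a \<Rightarrow> 'a \<Rightarrow> nat \<Rightarrow> 'a" where
  "subdivision_shift p1 p2 p3 i = (1/2) *\<^sub>R
    (if i = 1 then p1 else if i = 2 then p2 else if i = 3 then p3 else 0)"

definition subdivision_map :: "'a::real_vector \<Rightarrow> 'a \<Rightarrow> 'a \<Rightarrow> nat \<Rightarrow> 'a \<Rightarrow> 'a" where
  "subdivision_map p1 p2 p3 i x = subdivision_shift p1 p2 p3 i + subdivision_ratio i *\<^sub>R x"

lemma midpoint_subdivision_eq_image:
  assumes centroid: "p1 + p2 + p3 = 0"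
  shows "midpoint_subdivision p1 p2 p3 i =
    subdivision_map p1 p2 p3 i ` (convex hull {p1, p2, p3})"
proof -
  let ?T = "subdivision_map p1 p2 p3 i"
  have half: "(1/2) *\<^sub>R x + (1/2) *\<^sub>R x = x" for x :: "real^3"
    by (simp flip: scaleR_left_distrib)
  have p3: "p3 = - p1 - p2"
    using centroid by (simp add: eq_neg_iff_add_eq_0 algebra_simps)
  have "?T ` (convex hull {p1, p2, p3}) = convex hull (?T ` {p1, p2, p3})"
    unfolding subdivision_map_def by (rule convex_hull_affinity[symmetric])
  also have "\<dots> = midpoint_subdivision p1 p2 p3 i"
  proof (cases "i \<in> {1, 2, 3}")
    case True
    then show ?thesis
      by (auto simp: midpoint_subdivision_def subdivision_map_def subdivision_shift_def
          subdivision_ratio_def midpoint_def half scaleR_add_right insert_commute add.commute)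
  next
    case False
    then have "?T ` {p1, p2, p3} = {midpoint p2 p3, midpoint p3 p1, midpoint p1 p2}"
      by (simp add: subdivision_map_def subdivision_shift_def subdivision_ratio_def
          midpoint_def p3 scaleR_add_right scaleR_diff_right add.commute)
    then show ?thesis
      using False by (simp add: midpoint_subdivision_def insert_commute)
  qed
  finally show ?thesis ..
qed

lemma convex_hull_eq_Union_subdivision:
  fixes p1 p2 p3 :: "'a::real_vector"
  assumes centroid: "p1 + p2 + p3 = 0"
  shows "convex hull {p1, p2, p3} =
    (\<Union>i\<in>{1..4}. subdivision_map p1 p2 p3 i ` (convex hull {p1, p2, p3}))"
    (is "?S = (\<Union>i\<in>_. ?T i ` ?S)")
proof
  have p3: "p3 = - p1 - p2"
    using centroid by (simp add: eq_neg_iff_add_eq_0 algebra_simps)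
  have mem: "u *\<^sub>R p1 + v *\<^sub>R p2 + w *\<^sub>R p3 \<in> ?S"
    if "0 \<le> u" "0 \<le> v" "0 \<le> w" "u + v + w = 1" for u v w
    using that unfolding convex_hull_3 by blast
  have piece: "x \<in> ?T i ` ?S"
    if "0 \<le> u" "0 \<le> v" "0 \<le> w" "u + v + w = 1" "x = ?T i (u *\<^sub>R p1 + v *\<^sub>R p2 + w *\<^sub>R p3)"
    for u v w x i
    using mem[OF that(1-4)] that(5) by blast
  show "?S \<subseteq> (\<Union>i\<in>{1..4}. ?T i ` ?S)"
  proof
    fix x assume "x \<in> ?S"
    then obtain u v w where uvw: "0 \<le> u" "0 \<le> v" "0 \<le> w" "u + v + w = 1"
      and x: "x = u *\<^sub>R p1 + v *\<^sub>R p2 + w *\<^sub>R p3"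
      unfolding convex_hull_3 by blast
    consider "1/2 \<le> u" | "1/2 \<le> v" | "1/2 \<le> w" | "u \<le> 1/2" "v \<le> 1/2" "w \<le> 1/2"
      by linarith
    then have "\<exists>i\<in>{1..4}. x \<in> ?T i ` ?S"
    proof cases
      case 1
      have "x \<in> ?T 1 ` ?S"
        by (rule piece[of "2 * u-1" "2 * v" "2 * w"]) (use 1 uvw in \<open>auto simp: x subdivision_map_def
          subdivision_shift_def subdivision_ratio_def algebra_simps\<close>)
      then show ?thesis
        by (intro bexI[of _ 1]) simp_all
    next
      case 2
      have "x \<in> ?T 2 ` ?S"
        by (rule piece[of "2 * u" "2 * v-1" "2 * w"]) (use 2 uvw in \<open>auto simp: x subdivision_map_def
          subdivision_shift_def subdivision_ratio_def algebra_simps\<close>)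
      then show ?thesis
        by (intro bexI[of _ 2]) simp_all
    next
      case 3
      have "x \<in> ?T 3 ` ?S"
        by (rule piece[of "2 * u" "2 * v" "2 * w-1"]) (use 3 uvw in \<open>auto simp: x subdivision_map_def
          subdivision_shift_def subdivision_ratio_def algebra_simps\<close>)
      then show ?thesis
        by (intro bexI[of _ 3]) simp_all
    next
      case 4
      have "x \<in> ?T 4 ` ?S"
        by (rule piece[of "1-2 * u" "1-2 * v" "1-2 * w"]) (use 4 uvw in \<open>auto simp: x p3 subdivision_map_def
          subdivision_shift_def subdivision_ratio_def algebra_simps\<close>)
      then show ?thesis
        by (intro bexI[of _ 4]) simp_all
    qed
    then show "x \<in> (\<Union>i\<in>{1..4}. ?T i ` ?S)"
      by blast
  qed
  show "(\<Union>i\<in>{1..4}. ?T i ` ?S) \<subseteq> ?S"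
  proof (rule UN_least, rule image_subsetI)
    fix i :: nat and x assume x: "x \<in> ?S"
    have combine: "(1/2) *\<^sub>R y + (1/2) *\<^sub>R x \<in> ?S" if "y \<in> {p1, p2, p3}" for y
      using x hull_inc[OF that] by (intro convexD[OF convex_convex_hull]) auto
    show "?T i x \<in> ?S"
    proof (cases "i \<in> {1, 2, 3}")
      case True
      then show ?thesis
        using combine by (auto simp: subdivision_map_def subdivision_shift_def subdivision_ratio_def)
    next
      case False
      obtain u v w where uvw: "0 \<le> u" "0 \<le> v" "0 \<le> w" "u + v + w = 1"
        and x: "x = u *\<^sub>R p1 + v *\<^sub>R p2 + w *\<^sub>R p3"
        using x unfolding convex_hull_3 by blast
      have "?T i x = ((1-u)/2) *\<^sub>R p1 + ((1-v)/2) *\<^sub>R p2 + ((1-w)/2) *\<^sub>R p3"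
        using False by (simp add: x p3 subdivision_map_def subdivision_shift_def
            subdivision_ratio_def algebra_simps diff_divide_distrib)
      then show ?thesis
        using uvw by (simp only:) (intro mem, auto simp: field_simps)
    qed
  qed
qed

lemma subspace_affine_hull_triangle:
  fixes p1 p2 p3 :: "'a::euclidean_space"
  assumes centroid: "p1 + p2 + p3 = 0"
  shows "subspace (affine hull (convex hull {p1, p2, p3}))"
proof -
  have "(1/3) *\<^sub>R p1 + (1/3) *\<^sub>R p2 + (1/3) *\<^sub>R p3 = (1/3) *\<^sub>R (p1 + p2 + p3)"
    by (simp only: scaleR_add_right)
  moreover have "(1/3) *\<^sub>R p1 + (1/3) *\<^sub>R p2 + (1/3) *\<^sub>R p3 \<in> convex hull {p1, p2, p3}"
    unfolding convex_hull_3 by (rule CollectI, rule exI[of _ "1/3"], rule exI[of _ "1/3"],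
        rule exI[of _ "1/3"]) simp
  ultimately have "0 \<in> convex hull {p1, p2, p3}"
    using centroid by simp
  then have "0 \<in> affine hull (convex hull {p1, p2, p3})"
    by (rule hull_inc)
  then show ?thesis
    by (simp add: subspace_affine)
qed

lemma affine_hull_subdivision:
  fixes p1 p2 p3 :: "'a::euclidean_space"
  assumes centroid: "p1 + p2 + p3 = 0"
  shows "affine hull (subdivision_map p1 p2 p3 i ` (convex hull {p1, p2, p3})) =
    affine hull (convex hull {p1, p2, p3})" (is "affine hull (?T ` ?S) = ?P")
proof -
  let ?\<alpha> = "subdivision_ratio i" and ?c = "subdivision_shift p1 p2 p3 i"
  note P = subspace_affine_hull_triangle[OF centroid]
  have c: "?c \<in> ?P"
    using subspace_scale[OF P, of _ "1/2"] subspace_0[OF P] hull_inc[of _ "{p1, p2, p3}" affine]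
    by (simp add: subdivision_shift_def)
  have \<alpha>: "?\<alpha> \<noteq> 0"
    by (simp add: subdivision_ratio_def)
  have "?T ` ?S = (\<lambda>x. ?c + x) ` ((\<lambda>x. ?\<alpha> *\<^sub>R x) ` ?S)"
    by (auto simp: subdivision_map_def)
  then have "affine hull (?T ` ?S) = (\<lambda>x. ?c + x) ` ((\<lambda>x. ?\<alpha> *\<^sub>R x) ` ?P)"
    by (simp only: affine_hull_translation affine_hull_linear_image[OF bounded_linear_scaleR_right])
  also have "\<dots> = ?P"
  proof
    show "(\<lambda>x. ?c + x) ` ((\<lambda>x. ?\<alpha> *\<^sub>R x) ` ?P) \<subseteq> ?P"
      using c P by (auto intro: subspace_add subspace_scale)
    show "?P \<subseteq> (\<lambda>x. ?c + x) ` ((\<lambda>x. ?\<alpha> *\<^sub>R x) ` ?P)"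
    proof
      fix y assume "y \<in> ?P"
      then have "(1/?\<alpha>) *\<^sub>R (y - ?c) \<in> ?P"
        using c P by (intro subspace_scale subspace_diff)
      moreover have "y = ?c + ?\<alpha> *\<^sub>R ((1/?\<alpha>) *\<^sub>R (y - ?c))"
        using \<alpha> by simp
      ultimately show "y \<in> (\<lambda>x. ?c + x) ` ((\<lambda>x. ?\<alpha> *\<^sub>R x) ` ?P)"
        by blast
    qed
  qed
  finally show ?thesis .
qed

theorem mainTheorem4:
  fixes F :: "real^3 \<Rightarrow> complex" and s :: "real \<Rightarrow> complex"
    and p1 p2 p3 p p' :: "real^3" and S R :: "(real^3) set"
    and S' R' :: "nat \<Rightarrow> (real^3) set"
    and a :: complex
  assumes homogeneous: "\<And>\<alpha> r. \<alpha> \<noteq> 0 \<Longrightarrow> r \<noteq> 0 \<Longrightarrow> F (\<alpha> *\<^sub>R r) = s \<alpha> * F r"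
    and nondegenerate: "\<not> collinear {p1, p2, p3}"
    and S_def: "S = convex hull {p1, p2, p3}"
    and R_def: "R = S"
    and centroid: "p1 + p2 + p3 = 0"
    and abs_integrable: "abs_integrable_kernel F S R"
    and S'_def: "S' = midpoint_subdivision p1 p2 p3"
    and R'_def: "R' = midpoint_subdivision p1 p2 p3"
    and a_def: "a = 1/64 * s (1/2) *
       of_real ((p \<bullet> p1) * (p' \<bullet> p1) + (p \<bullet> p2) * (p' \<bullet> p2) + (p \<bullet> p3) * (p' \<bullet> p3)) *
       I_one F S R"
  shows
    "(1 - 3/16 * s (1/2) - 1/16 * s (-1/2) \<noteq> 0 \<longrightarrow>
        I_one F S R =
          inverse (1 - 3/16 * s (1/2) - 1/16 * s (-1/2)) * remainder (I_one F) S' R') \<and>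
     (1 - 3/32 * s (1/2) + 1/32 * s (-1/2) \<noteq> 0 \<longrightarrow>
        I_src F p' S R =
          inverse (1 - 3/32 * s (1/2) + 1/32 * s (-1/2)) * remainder (I_src F p') S' R') \<and>
     (1 - 3/32 * s (1/2) + 1/32 * s (-1/2) \<noteq> 0 \<longrightarrow>
        I_rec F p S R =
          inverse (1 - 3/32 * s (1/2) + 1/32 * s (-1/2)) * remainder (I_rec F p) S' R') \<and>
     (1 - 3/64 * s (1/2) - 1/64 * s (-1/2) \<noteq> 0 \<longrightarrow>
        I_src_rec F p' p S R =
          inverse (1 - 3/64 * s (1/2) - 1/64 * s (-1/2)) *
            (remainder (I_src_rec F p' p) S' R' + a))"
proof -
  let ?P = "affine hull S"
  let ?T = "subdivision_map p1 p2 p3" and ?c = "subdivision_shift p1 p2 p3"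
  define M where "M = (distr lborel borel (SOME \<phi>. plane_isometry ?P \<phi>) :: (real^3) measure)"
  have P: "subspace ?P"
    unfolding S_def by (rule subspace_affine_hull_triangle[OF centroid])
  have "plane_isometry ?P (SOME \<phi>. plane_isometry ?P \<phi>)"
    using plane_isometry_exists[OF nondegenerate] unfolding S_def by (rule someI_ex)
  then interpret homogeneous_measure M ?P 2
    unfolding M_def using P by (rule homogeneous_measure_plane)
  have dS_S: "dS S = completion M"
    by (simp add: dS_def plane_area_def M_def)
  have S'_image: "S' i = ?T i ` S" for i
    unfolding S'_def S_def by (rule midpoint_subdivision_eq_image[OF centroid])
  have dS_S': "dS (S' i) = completion M" for i
    using affine_hull_subdivision[OF centroid, of i] dS_S by (simp add: dS_def S'_image S_def)
  note dS = dS_S dS_S'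
  have R'S': "R' = S'"
    by (simp add: R'_def S'_def)
  have S: "compact S"
    unfolding S_def by (intro finite_imp_compact_convex_hull) simp
  have F: "set_integrable pair_area (S \<times> S) (\<lambda>(x, x'). F (x - x'))"
    using abs_integrable by (simp add: abs_integrable_kernel_def R_def dS_S)
  have vertex: "p1 \<in> ?P" "p2 \<in> ?P" "p3 \<in> ?P"
    unfolding S_def by (auto intro!: hull_inc)
  have c: "?c i \<in> ?P" for i
    using vertex P by (auto simp: subdivision_shift_def intro!: subspace_scale subspace_0)
  have four: "{1..4} = {1, 2, 3, 4 :: nat}"
    by auto
  have split: "double_integral F w S S =
      s (1/2) / 16 * (\<Sum>i\<in>{1,2,3}. double_integral F (\<lambda>x x'. w (?T i x) (?T i x')) S S) +
      s (-1/2) / 16 * double_integral F (\<lambda>x x'. w (?T 4 x) (?T 4 x')) S S +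
      remainder (double_integral F w) S' R'"
    if w: "continuous_on UNIV (\<lambda>z. w (fst z) (snd z))" for w
  proof -
    have "double_integral F w S S =
      (\<Sum>i\<in>{1..4}. of_real (\<bar>subdivision_ratio i\<bar> ^ (2 * 2)) * s (subdivision_ratio i) *
        double_integral F (\<lambda>x x'. w (?T i x) (?T i x')) S S) +
      (\<Sum>(i, j)\<in>{(i, j) \<in> {1..4} \<times> {1..4}. i \<noteq> j}. double_integral F w (?T i ` S) (?T j ` S))"
    proof (rule double_integral_self_similar[OF S F w homogeneous])
      show "S = (\<Union>i\<in>{1..4}. ?T i ` S)"
        unfolding S_def by (rule convex_hull_eq_Union_subdivision[OF centroid])
      show "(\<Sum>i\<in>{1..4}. \<bar>subdivision_ratio i\<bar> ^ 2) = 1"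
        unfolding four by (simp add: subdivision_ratio_def power2_eq_square)
      show "?T i x = ?c i + subdivision_ratio i *\<^sub>R x" for i x
        by (rule subdivision_map_def)
      show "?c i \<in> ?P" for i
        by (rule c)
      show "subdivision_ratio i \<noteq> 0" for i
        by (simp add: subdivision_ratio_def)
    qed auto
    then show ?thesis
      unfolding remainder_def R'S' S'_image four
      by (simp add: subdivision_ratio_def power_divide distrib_left)
  qed
  let ?src = "\<lambda>(x :: real^3) x'. complex_of_real (p' \<bullet> x')"
  let ?rec = "\<lambda>x (x' :: real^3). complex_of_real (p \<bullet> x)"
  let ?both = "\<lambda>x x'. complex_of_real (p' \<bullet> x') * complex_of_real (p \<bullet> x)"
  have cont: "continuous_on UNIV (\<lambda>z. 1 :: complex)"
    "continuous_on UNIV (\<lambda>z. ?src (fst z) (snd z))" "continuous_on UNIV (\<lambda>z. ?rec (fst z) (snd z))"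
    "continuous_on UNIV (\<lambda>z. ?both (fst z) (snd z))"
    by (intro continuous_intros)+
  define J1 where "J1 = double_integral F (\<lambda>_ _. 1) S S"
  define Jsrc where "Jsrc = double_integral F ?src S S"
  define Jrec where "Jrec = double_integral F ?rec S S"
  define Jboth where "Jboth = double_integral F ?both S S"
  have affine: "double_integral F
      (\<lambda>x x'. k1 * 1 + (k2 * ?src x x' + (k3 * ?rec x x' + k4 * ?both x x'))) S S =
      k1 * J1 + k2 * Jsrc + k3 * Jrec + k4 * Jboth" for k1 k2 k3 k4
  proof -
    have "double_integral F (\<lambda>x x'. k3 * ?rec x x' + k4 * ?both x x') S S = k3 * Jrec + k4 * Jboth"
      unfolding Jrec_def Jboth_def double_integral_cmult[symmetric]
      by (rule double_integral_add[OF S F]) (intro continuous_intros)+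
    moreover have "double_integral F (\<lambda>x x'. k2 * ?src x x' + (k3 * ?rec x x' + k4 * ?both x x')) S S =
        k2 * Jsrc + double_integral F (\<lambda>x x'. k3 * ?rec x x' + k4 * ?both x x') S S"
      unfolding Jsrc_def double_integral_cmult[symmetric]
      by (rule double_integral_add[OF S F]) (intro continuous_intros)+
    moreover have "double_integral F
        (\<lambda>x x'. k1 * 1 + (k2 * ?src x x' + (k3 * ?rec x x' + k4 * ?both x x'))) S S =
        k1 * J1 + double_integral F (\<lambda>x x'. k2 * ?src x x' + (k3 * ?rec x x' + k4 * ?both x x')) S S"
      unfolding J1_def double_integral_cmult[symmetric]
      by (rule double_integral_add[OF S F]) (intro continuous_intros)+
    ultimately show ?thesis
      by simp
  qed
  have src: "double_integral F (\<lambda>x x'. ?src (?T i x) (?T i x')) S S =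
      of_real (p' \<bullet> ?c i) * J1 + of_real (subdivision_ratio i) * Jsrc" for i
    using affine[of "of_real (p' \<bullet> ?c i)" "of_real (subdivision_ratio i)" 0 0]
    by (simp add: subdivision_map_def inner_add_right)
  have rec: "double_integral F (\<lambda>x x'. ?rec (?T i x) (?T i x')) S S =
      of_real (p \<bullet> ?c i) * J1 + of_real (subdivision_ratio i) * Jrec" for i
    using affine[of "of_real (p \<bullet> ?c i)" 0 "of_real (subdivision_ratio i)" 0]
    by (simp add: subdivision_map_def inner_add_right)
  have both: "double_integral F (\<lambda>x x'. ?both (?T i x) (?T i x')) S S =
      of_real (p' \<bullet> ?c i) * of_real (p \<bullet> ?c i) * J1 +
      of_real (subdivision_ratio i) * of_real (p \<bullet> ?c i) * Jsrc +
      of_real (subdivision_ratio i) * of_real (p' \<bullet> ?c i) * Jrec +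
      of_real (subdivision_ratio i) * of_real (subdivision_ratio i) * Jboth" for i
    unfolding affine[symmetric]
    by (simp add: subdivision_map_def inner_add_right algebra_simps)
  have zero: "of_real (q \<bullet> p1) + of_real (q \<bullet> p2) + of_real (q \<bullet> p3) = (0 :: complex)" for q
    using arg_cong[OF centroid, of "\<lambda>x. q \<bullet> x"] by (simp add: inner_add_right flip: of_real_add)
  have J_one: "I_one F S S = J1" "I_one F (S' i) (S' j) = double_integral F (\<lambda>_ _. 1) (S' i) (S' j)" for i j
    by (simp_all add: I_one_def double_integral_def dS J1_def)
  have J_src: "I_src F p' S S = Jsrc" "I_src F p' (S' i) (S' j) = double_integral F ?src (S' i) (S' j)" for i j
    by (simp_all add: I_src_def double_integral_def dS Jsrc_def)
  have J_rec: "I_rec F p S S = Jrec" "I_rec F p (S' i) (S' j) = double_integral F ?rec (S' i) (S' j)" for i j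
    by (simp_all add: I_rec_def double_integral_def dS Jrec_def)
  have J_both: "I_src_rec F p' p S S = Jboth"
    "I_src_rec F p' p (S' i) (S' j) = double_integral F ?both (S' i) (S' j)" for i j
    by (simp_all add: I_src_rec_def double_integral_def dS Jboth_def)
  have rem: "remainder J S' R' = remainder J' S' R'"
    if "\<And>i j. J (S' i) (S' j) = J' (S' i) (S' j)" for J J'
    by (simp add: remainder_def R'S' that)
  have eq_one: "J1 = (3/16 * s (1/2) + 1/16 * s (-1/2)) * J1 + remainder (I_one F) S' R'"
    using split[OF cont(1)] unfolding rem[of "I_one F", OF J_one(2)]
    by (simp add: algebra_simps flip: J1_def)
  have eq_src: "Jsrc = (3/32 * s (1/2) - 1/32 * s (-1/2)) * Jsrc + remainder (I_src F p') S' R'"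
  proof -
    have "Jsrc = (3/32 * s (1/2) - 1/32 * s (-1/2)) * Jsrc + remainder (I_src F p') S' R' +
        s (1/2) / 32 * J1 * (of_real (p' \<bullet> p1) + of_real (p' \<bullet> p2) + of_real (p' \<bullet> p3))"
      using split[OF cont(2)] unfolding rem[of "I_src F p'", OF J_src(2)] src
      by (simp add: subdivision_shift_def subdivision_ratio_def algebra_simps flip: Jsrc_def)
    then show ?thesis
      by (simp add: zero)
  qed
  have eq_rec: "Jrec = (3/32 * s (1/2) - 1/32 * s (-1/2)) * Jrec + remainder (I_rec F p) S' R'"
  proof -
    have "Jrec = (3/32 * s (1/2) - 1/32 * s (-1/2)) * Jrec + remainder (I_rec F p) S' R' +
        s (1/2) / 32 * J1 * (of_real (p \<bullet> p1) + of_real (p \<bullet> p2) + of_real (p \<bullet> p3))"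
      using split[OF cont(3)] unfolding rem[of "I_rec F p", OF J_rec(2)] rec
      by (simp add: subdivision_shift_def subdivision_ratio_def algebra_simps flip: Jrec_def)
    then show ?thesis
      by (simp add: zero)
  qed
  have eq_both: "Jboth = (3/64 * s (1/2) + 1/64 * s (-1/2)) * Jboth +
      (remainder (I_src_rec F p' p) S' R' + a)"
  proof -
    have "a = 1/64 * s (1/2) * (of_real (p \<bullet> p1) * of_real (p' \<bullet> p1) +
        of_real (p \<bullet> p2) * of_real (p' \<bullet> p2) + of_real (p \<bullet> p3) * of_real (p' \<bullet> p3)) * J1"
      by (simp add: a_def R_def J_one(1))
    then have "Jboth = (3/64 * s (1/2) + 1/64 * s (-1/2)) * Jboth +
        (remainder (I_src_rec F p' p) S' R' + a) +
        s (1/2) / 64 * Jsrc * (of_real (p \<bullet> p1) + of_real (p \<bullet> p2) + of_real (p \<bullet> p3)) +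
        s (1/2) / 64 * Jrec * (of_real (p' \<bullet> p1) + of_real (p' \<bullet> p2) + of_real (p' \<bullet> p3))"
      using split[OF cont(4)] unfolding rem[of "I_src_rec F p' p", OF J_both(2)] both
      unfolding Jboth_def[symmetric]
      by (simp add: subdivision_shift_def subdivision_ratio_def algebra_simps add_divide_distrib)
    then show ?thesis
      by (simp add: zero)
  qed
  have solve: "x = inverse k * r" if "x = q * x + r" "k \<noteq> 0" "k = 1 - q" for x k q r :: complex
  proof -
    have "x - q * x = r"
      using that(1) by (metis add_diff_cancel_left')
    then have "k * x = r"
      using that(3) by (simp add: left_diff_distrib)
    then show ?thesis
      using that(2) by (simp add: field_simps)
  qed
  show ?thesis
    unfolding R_def J_one(1) J_src(1) J_rec(1) J_both(1)
    by (intro conjI impI; rule solve[OF eq_one] solve[OF eq_src] solve[OF eq_rec] solve[OF eq_both])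
      (assumption | simp)+
qed

end
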